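(* Let $n,k\ge 1$. For any $k$-tensor $T$ on $\mathbb{R}^n$, any real $n\times n$ matrices $H_1,\dots,H_k$, and any permutation $\sigma$ on $\mathbb{N}_k$ we have the identity $$\langle T, H_1\circ_\sigma \cdots\circ_\sigma H_k\rangle = (\mathrm{Diag}^{\sigma}\,T)[H_1,\dots,H_k].$$
   Context: $\mathbb{N}_k=\{1,\dots,k\}$. A $k$-tensor $T$ on $\mathbb{R}^n$ is a multilinear real map on $(\mathbb{R}^n)^k$, identified (standard basis) with an array of real entries $T^{i_1\dots i_k}$, $1\le i_s\le n$. Scalar product: $\langle T_1,T_2\rangle=\sum_{i_1,\dots,i_k=1}^n T_1^{i_1\dots i_k}T_2^{i_1\dots i_k}$. $H^{ij}$ denotes the $(i,j)$ entry of a matrix $H$. $\sigma$-Hadamard product: let $H_{pq}$ be the matrix with $1$ in position $(p,q)$ and $0$ elsewhere. For a permutation $\sigma$ on $\mathbb{N}_k$, $(H_{p_1q_1}\circ_\sigma\cdots\circ_\sigma H_{p_kq_k})^{i_1\dots i_k}=1$ if $i_s=p_s=q_{\sigma(s)}$ for all $s=1,\dots,k$, and $0$ otherwise; the product is extended to a $k$-tensor valued map of $k$ matrix arguments, linear in each argument separately. $\mathrm{Diag}^{\sigma}T$ is the $2k$-tensor with entries, indexed by pairs of multi-indices $(i_1\dots i_k;\,j_1\dots j_k)$, equal to $T^{i_1\dots i_k}$ if $i_s=j_{\sigma(s)}$ for all $s=1,\dots,k$, and $0$ otherwise. A $2k$-tensor $S$ is evaluated at $k$ matrices by $S[H_1,\dots,H_k]=\sum_{p_1,q_1,\dots,p_k,q_k=1}^n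 S^{p_1\dots p_k;\,q_1\dots q_k}H_1^{p_1q_1}\cdots H_k^{p_kq_k}$. *)

theory Defs
  imports "HOL-Analysis.Analysis"
begin

text \<open>
  The index set \<open>{1..k}\<close> is rendered by a finite type \<open>'k\<close>, and the coordinates of
  \<open>\<real>\<^sup>n\<close> by a finite type \<open>'n\<close>.  A tensor is identified with its array of entries in the
  standard basis; the library inner product on this type is the sum over all multi-indices of
  the products of entries.
\<close>

type_synonym ('k, 'n) tensor = "real ^ ('k \<Rightarrow> 'n)"

definition unit_matrix :: "'n \<Rightarrow> 'n \<Rightarrow> real ^ 'n::finite ^ 'n" where
  "unit_matrix p q = (\<chi> i j. if i = p \<and> j = q then 1 else 0)"

definition hadamard_unit ::
  "('k \<Rightarrow> 'k) \<Rightarrow> ('k \<Rightarrow> 'n) \<Rightarrow> ('k \<Rightarrow> 'n) \<Rightarrow> ('k::finite, 'n::finite) tensor" where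
  "hadamard_unit \<sigma> p q = (\<chi> i. if \<forall>s. i s = p s \<and> p s = q (\<sigma> s) then 1 else 0)"

text \<open>
  The extension to arbitrary matrices that is linear in each argument: expand every \<open>H s\<close> in
  the basis of unit matrices.  The three lemmas below confirm that this is the unique such
  extension.
\<close>

definition hadamard ::
  "('k \<Rightarrow> 'k) \<Rightarrow> ('k \<Rightarrow> real ^ 'n ^ 'n) \<Rightarrow> ('k::finite, 'n::finite) tensor" where
  "hadamard \<sigma> H =
     (\<Sum>p\<in>UNIV. \<Sum>q\<in>UNIV. (\<Prod>s\<in>UNIV. H s $ p s $ q s) *\<^sub>R hadamard_unit \<sigma> p q)"

text \<open>
  The \<open>2k\<close> index positions form the type \<open>'k + 'k\<close>; the entry \<open>(i; j)\<close> of a \<open>2k\<close>-tensor \<open>S\<close>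
  is \<open>S $ case_sum i j\<close>.
\<close>

definition Diag ::
  "('k \<Rightarrow> 'k) \<Rightarrow> ('k::finite, 'n::finite) tensor \<Rightarrow> ('k + 'k, 'n) tensor" where
  "Diag \<sigma> T =
     (\<chi> m. let i = (\<lambda>s. m (Inl s)); j = (\<lambda>s. m (Inr s))
           in if \<forall>s. i s = j (\<sigma> s) then T $ i else 0)"

definition tensor_eval ::
  "('k + 'k, 'n) tensor \<Rightarrow> ('k::finite \<Rightarrow> real ^ 'n ^ 'n) \<Rightarrow> real" where
  "tensor_eval S H =
     (\<Sum>p\<in>UNIV. \<Sum>q\<in>UNIV. S $ case_sum p q * (\<Prod>s\<in>UNIV. H s $ p s $ q s))"

lemma Diag_entry:
  "Diag \<sigma> T $ case_sum i j = (if \<forall>s. i s = j (\<sigma> s) then T $ i else 0)"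
  by (simp only: Diag_def Let_def vec_lambda_beta sum.case)

lemma hadamard_unit_matrix:
  "hadamard \<sigma> (\<lambda>s. unit_matrix (p s) (q s)) = hadamard_unit \<sigma> p q"
proof -
  have "(\<Prod>s\<in>UNIV. unit_matrix (p s) (q s) $ p' s $ q' s) = (if p' = p \<and> q' = q then 1 else 0)"
    for p' q'
    by (auto simp: unit_matrix_def fun_eq_iff intro!: prod.neutral prod_zero)
  then have "hadamard \<sigma> (\<lambda>s. unit_matrix (p s) (q s)) =
      (\<Sum>p'\<in>UNIV. \<Sum>q'\<in>UNIV. if p' = p then if q' = q then hadamard_unit \<sigma> p q else 0 else 0)"
    unfolding hadamard_def by (intro sum.cong refl) auto
  also have "\<dots> = (\<Sum>p'\<in>UNIV. if p' = p then hadamard_unit \<sigma> p q else 0)"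
    by (intro sum.cong refl) auto
  finally show ?thesis
    by simp
qed

lemma linear_hadamard: "linear (\<lambda>X. hadamard \<sigma> (H(s := X)))"
proof -
  have eq: "(\<Prod>t\<in>UNIV. (H(s := X)) t $ p t $ q t) =
      X $ p s $ q s * (\<Prod>t\<in>UNIV - {s}. H t $ p t $ q t)" for X p q
    by (subst prod.remove[of _ s]) (auto intro!: prod.cong)
  show ?thesis
    unfolding hadamard_def eq
    by (rule linearI)
      (simp_all add: distrib_right scaleR_add_left sum.distrib scaleR_sum_right mult.assoc)
qed

lemma hadamard_unique:
  fixes F :: "('k::finite \<Rightarrow> real ^ 'n ^ 'n) \<Rightarrow> ('k, 'n::finite) tensor"
  assumes lin: "\<And>H s. linear (\<lambda>X. F (H(s := X)))"
    and unit: "\<And>p q. F (\<lambda>s. unit_matrix (p s) (q s)) = hadamard_unit \<sigma> p q"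
  shows "F = hadamard \<sigma>"
proof -
  have expand: "X = (\<Sum>p\<in>UNIV. \<Sum>q\<in>UNIV. X $ p $ q *\<^sub>R unit_matrix p q)" for X :: "real ^ 'n ^ 'n"
  proof -
    have "(\<Sum>p\<in>UNIV. \<Sum>q\<in>UNIV. X $ p $ q * (if i = p \<and> j = q then 1 else 0)) =
        (\<Sum>p\<in>UNIV. if p = i then X $ i $ j else 0)" for i j
      by (intro sum.cong refl) (auto simp: if_distrib cong: if_cong)
    then show ?thesis
      by (simp add: vec_eq_iff unit_matrix_def)
  qed
  have slot: "G H = (\<Sum>p\<in>UNIV. \<Sum>q\<in>UNIV. H a $ p $ q *\<^sub>R G (H(a := unit_matrix p q)))"
    if "\<And>H s. linear (\<lambda>X. G (H(s := X)))"
    for G :: "('k \<Rightarrow> real ^ 'n ^ 'n) \<Rightarrow> ('k, 'n) tensor" and H a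
  proof -
    have "G H = G (H(a := \<Sum>p\<in>UNIV. \<Sum>q\<in>UNIV. H a $ p $ q *\<^sub>R unit_matrix p q))"
      using expand[of "H a"] by simp
    then show ?thesis
      by (simp add: linear_sum[OF that] linear_scale[OF that])
  qed
  have "\<forall>H. (\<forall>s. s \<notin> A \<longrightarrow> (\<exists>p q. H s = unit_matrix p q)) \<longrightarrow> F H = hadamard \<sigma> H"
    if "finite A" for A :: "'k set"
    using that
  proof induction
    case empty
    show ?case
    proof (intro allI impI)
      fix H :: "'k \<Rightarrow> real ^ 'n ^ 'n"
      assume "\<forall>s. s \<notin> {} \<longrightarrow> (\<exists>p q. H s = unit_matrix p q)"
      then obtain p q where "H = (\<lambda>s. unit_matrix (p s) (q s))"
        by (simp add: fun_eq_iff) metis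
      then show "F H = hadamard \<sigma> H"
        by (simp add: unit hadamard_unit_matrix)
    qed
  next
    case (insert a A)
    show ?case
    proof (intro allI impI)
      fix H :: "'k \<Rightarrow> real ^ 'n ^ 'n"
      assume *: "\<forall>s. s \<notin> insert a A \<longrightarrow> (\<exists>p q. H s = unit_matrix p q)"
      have "F (H(a := unit_matrix p q)) = hadamard \<sigma> (H(a := unit_matrix p q))" for p q
        by (rule insert.IH[rule_format]) (use * in auto)
      then show "F H = hadamard \<sigma> H"
        by (simp only: slot[OF lin, of H a] slot[OF linear_hadamard, of \<sigma> H a])
    qed
  qed
  from this[of UNIV] show ?thesis
    by (simp add: fun_eq_iff)
qed

end

theory Submission
  imports Defs
begin

text \<open>Both sides expand over multi-indices \<open>p\<close>, \<open>q\<close> with the same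
  coefficients, the products of the entries \<open>H s $ p s $ q s\<close>. So it suffices to match
  the remaining factors for fixed \<open>p\<close> and \<open>q\<close>, which is
  \<open>inner_hadamard_unit\<close>.\<close>

lemma hadamard_unit_eq_axis:
  "hadamard_unit \<sigma> p q = (if \<forall>s. p s = q (\<sigma> s) then axis p 1 else 0)"
  by (auto simp: hadamard_unit_def axis_def vec_eq_iff fun_eq_iff)

text \<open>A nonzero unit product is the basis tensor at \<open>p\<close>, so pairing with it reads
  off \<open>T $ p\<close>; it is nonzero exactly under the condition by which \<open>Diag\<close>
  keeps that entry.\<close>

lemma inner_hadamard_unit:
  "T \<bullet> hadamard_unit \<sigma> p q = Diag \<sigma> T $ case_sum p q"
  by (simp add: hadamard_unit_eq_axis Diag_entry inner_axis)

theorem corollary4p5: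
  fixes T :: "('k::finite, 'n::finite) tensor"
    and H :: "'k \<Rightarrow> real ^ 'n ^ 'n"
    and \<sigma> :: "'k \<Rightarrow> 'k"
  assumes "\<sigma> permutes UNIV"
  shows "T \<bullet> hadamard \<sigma> H = tensor_eval (Diag \<sigma> T) H"
  by (simp add: hadamard_def tensor_eval_def inner_sum_right inner_hadamard_unit mult.commute)

end
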